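(* For any $M_1\le M_2$ (the values $M_1=-\infty$ and $M_2=+\infty$ being allowed) and any $M\ge0$ the sets $\mathcal F_{S_{M_1,M_2}}$ and $\mathcal F_{B_M}$ are $\phi^\delta$-invariant, that is, $\phi^\delta(\mathcal F_{S_{M_1,M_2}})\subset\mathcal F_{S_{M_1,M_2}}$ and $\phi^\delta(\mathcal F_{B_M})\subset\mathcal F_{B_M}$ for every $\delta\ge0$.
   Context: Let $n\ge1$ and let $\omega\in\mathbb R^n$ be nonresonant: $\langle q,\omega\rangle\ne0$ for all $q\in\mathbb Z^n\setminus\{0\}$. Let $z=(z_1,\dots,z_n)$, $\overline z=(\overline z_1,\dots,\overline z_n)$ be independent complex variables (the bar is not complex conjugation), $\mathbf z=(z,\overline z)$. For $\mathbf k=(k,\overline k)\in\mathbb Z_+^{2n}$ put $\mathbf k'=\overline k-k\in\mathbb Z^n$, let $|\mathbf k|$ be the sum of all components, $\mathbf z^{\mathbf k}=z^k\overline z^{\overline k}$. Put $\mathbb Z_\diamond^{2n}=\{\mathbf k\in\mathbb Z_+^{2n}:|\mathbf k|\ge3\}$ and let $\mathcal F_\diamond$ be the space of formal power series $H_\diamond=\sum_{\mathbf k\in\mathbb Z_\diamond^{2n}}H_{\mathbf k}\mathbf z^{\mathbf k}$, $H_{\mathbf k}\in\mathbb C$. Put $S_{M_1,M_2}=\{\mathbf k\in\mathbb Z_\diamond^{2n}:M_1\le\langle\omega,\mathbf k'\rangle\le M_2\}$ (if $M_2=+\infty$ or $M_1=-\infty$ the corresponding inequality is void), $B_M=\{\mathbf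 k\in\mathbb Z_\diamond^{2n}:|\mathbf k|\le M\}$, $$\mathcal F_{S_{M_1,M_2}}=\{H_\diamond\in\mathcal F_\diamond:H_{\mathbf k}=0\text{ for any }\mathbf k\in\mathbb Z_\diamond^{2n}\setminus S_{M_1,M_2}\},$$ $$\mathcal F_{B_M}=\{H_\diamond\in\mathcal F_\diamond:H_{\mathbf k}=0\text{ for any }\mathbf k\in B_M\}.$$ Put $H_2=\sum_j\omega_jz_j\overline z_j$, $\{F,G\}=i\sum_{j=1}^n(\partial_{\overline z_j}F\,\partial_{z_j}G-\partial_{z_j}F\,\partial_{\overline z_j}G)$, and $\xi H_\diamond=-i\sum_{|\mathbf k|\ge3}\sigma_{\mathbf k'}H_{\mathbf k}\mathbf z^{\mathbf k}$, where $\sigma_q=\operatorname{sign}\langle\omega,q\rangle$ for $q\in\mathbb Z^n$ ($\sigma_0=0$). For $\widehat H_\diamond\in\mathcal F_\diamond$ and $\delta\ge0$, $\phi^\delta(\widehat H_\diamond)$ denotes the value at $\delta$ of the (unique, existing for all $\delta\ge0$) solution in $\mathcal F_\diamond$ of $\partial_\delta H_\diamond=-\{\xi H_\diamond,H_2+H_\diamond\}$, $H_\diamond|_{\delta=0}=\widehat H_\diamond$, understood as an infinite ODE system for the coefficients $H_{\mathbf k}(\delta)$. *)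

theory Defs
  imports "HOL-Analysis.Analysis"
begin

text \<open>
  A pair \<open>(k, kb)\<close> of multi-indices stands for the monomial \<open>z^k zb^kb\<close>, where \<open>z\<close> and \<open>zb\<close> are
  independent. A formal power series is identified with its coefficient function. Pointwise
  multiplication of coefficient functions is not the product of series; see \<open>series_mult\<close>.
\<close>

type_synonym 'n bimulti = "(nat ^ 'n) \<times> (nat ^ 'n)"
type_synonym 'n series = "'n bimulti \<Rightarrow> complex"

definition deg :: "'n::finite bimulti \<Rightarrow> nat" where
  "deg k = (\<Sum>j\<in>UNIV. fst k $ j) + (\<Sum>j\<in>UNIV. snd k $ j)"

definition idiff :: "'n::finite bimulti \<Rightarrow> int ^ 'n" where
  "idiff k = (\<chi> j. int (snd k $ j) - int (fst k $ j))"

definition freq :: "real ^ 'n::finite \<Rightarrow> int ^ 'n \<Rightarrow> real" where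
  "freq \<omega> q = \<omega> \<bullet> (\<chi> j. real_of_int (q $ j))"

definition nonresonant :: "real ^ 'n::finite \<Rightarrow> bool" where
  "nonresonant \<omega> \<longleftrightarrow> (\<forall>q. q \<noteq> 0 \<longrightarrow> freq \<omega> q \<noteq> 0)"

definition Z_diamond :: "'n::finite bimulti set" where
  "Z_diamond = {k. 3 \<le> deg k}"

definition F_diamond :: "'n::finite series set" where
  "F_diamond = {H. \<forall>k. k \<notin> Z_diamond \<longrightarrow> H k = 0}"


subsection \<open>Operations on formal power series\<close>

definition series_mult :: "'n::finite series \<Rightarrow> 'n series \<Rightarrow> 'n series" where
  "series_mult F G k = (\<Sum>(l, m) \<in> {(l, m). l + m = k}. F l * G m)"

text \<open>The sum in \<open>series_mult\<close> is a genuine one:\<close>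

lemma finite_bimulti_splits: "finite {(l, m). l + m = (k :: 'n::finite bimulti)}"
proof -
  have fin: "finite {a :: nat ^ 'n. \<forall>j. a $ j \<le> b $ j}" for b
  proof -
    have "finite {f. \<forall>j :: 'n. f j \<in> {.. b $ j}}"
      using finite_PiE[of "UNIV :: 'n set" "\<lambda>j. {.. b $ j}"] by (simp add: PiE_UNIV_domain Pi_def)
    then have "finite (vec_lambda ` {f. \<forall>j :: 'n. f j \<in> {.. b $ j}})"
      by (rule finite_imageI)
    moreover have "{a. \<forall>j. a $ j \<le> b $ j} \<subseteq> vec_lambda ` {f. \<forall>j :: 'n. f j \<in> {.. b $ j}}"
    proof
      fix a :: "nat ^ 'n"
      assume "a \<in> {a. \<forall>j. a $ j \<le> b $ j}"
      then show "a \<in> vec_lambda ` {f. \<forall>j :: 'n. f j \<in> {.. b $ j}}"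
        by (intro image_eqI[where x = "vec_nth a"]) auto
    qed
    ultimately show ?thesis
      by (rule finite_subset[rotated])
  qed
  let ?A = "{a. \<forall>j. a $ j \<le> fst k $ j} \<times> {a. \<forall>j. a $ j \<le> snd k $ j}"
  have "{(l, m). l + m = k} \<subseteq> ?A \<times> ?A"
    by auto
  then show ?thesis
    by (rule finite_subset) (intro finite_cartesian_product fin)
qed

text \<open>Formal partial derivatives with respect to \<open>z j\<close> and \<open>zb j\<close>.\<close>

definition d_z :: "'n::finite \<Rightarrow> 'n series \<Rightarrow> 'n series" where
  "d_z j F k = of_nat (fst k $ j + 1) * F (k + (axis j 1, 0))"

definition d_zb :: "'n::finite \<Rightarrow> 'n series \<Rightarrow> 'n series" where
  "d_zb j F k = of_nat (snd k $ j + 1) * F (k + (0, axis j 1))"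

definition poisson :: "'n::finite series \<Rightarrow> 'n series \<Rightarrow> 'n series" where
  "poisson F G k =
     \<i> * (\<Sum>j\<in>UNIV. series_mult (d_zb j F) (d_z j G) k - series_mult (d_z j F) (d_zb j G) k)"

definition H2 :: "real ^ 'n::finite \<Rightarrow> 'n series" where
  "H2 \<omega> k = (\<Sum>j\<in>UNIV. if k = (axis j 1, axis j 1) then complex_of_real (\<omega> $ j) else 0)"

definition sigma :: "real ^ 'n::finite \<Rightarrow> int ^ 'n \<Rightarrow> real" where
  "sigma \<omega> q = sgn (freq \<omega> q)"

definition xi :: "real ^ 'n::finite \<Rightarrow> 'n series \<Rightarrow> 'n series" where
  "xi \<omega> H k = (if 3 \<le> deg k then - \<i> * complex_of_real (sigma \<omega> (idiff k)) * H k else 0)"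


subsection \<open>The flow\<close>

text \<open>
  Coefficientwise solutions on \<open>[0, \<infinity>)\<close>; the derivative at \<open>0\<close> is one-sided, and values of \<open>H\<close> at
  negative times are irrelevant.
\<close>

definition flow_solution :: "real ^ 'n::finite \<Rightarrow> 'n series \<Rightarrow> (real \<Rightarrow> 'n series) \<Rightarrow> bool" where
  "flow_solution \<omega> H0 H \<longleftrightarrow>
     (\<forall>t\<ge>0. H t \<in> F_diamond) \<and> H 0 = H0 \<and>
     (\<forall>t\<ge>0. \<forall>k. ((\<lambda>s. H s k) has_vector_derivative
        - poisson (xi \<omega> (H t)) (\<lambda>l. H2 \<omega> l + H t l) k) (at t within {0..}))"

definition flow :: "real ^ 'n::finite \<Rightarrow> real \<Rightarrow> 'n series \<Rightarrow> 'n series" where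
  "flow \<omega> \<delta> H0 = (THE G. \<exists>H. flow_solution \<omega> H0 H \<and> G = H \<delta>)"


subsection \<open>The subspaces\<close>

text \<open>Infinite values of the bounds make the corresponding inequality void.\<close>

definition S_set :: "real ^ 'n::finite \<Rightarrow> ereal \<Rightarrow> ereal \<Rightarrow> 'n bimulti set" where
  "S_set \<omega> M1 M2 =
     {k \<in> Z_diamond. M1 \<le> ereal (freq \<omega> (idiff k)) \<and> ereal (freq \<omega> (idiff k)) \<le> M2}"

definition B_set :: "real \<Rightarrow> 'n::finite bimulti set" where
  "B_set M = {k \<in> Z_diamond. real (deg k) \<le> M}"

definition F_S :: "real ^ 'n::finite \<Rightarrow> ereal \<Rightarrow> ereal \<Rightarrow> 'n series set" where
  "F_S \<omega> M1 M2 = {H \<in> F_diamond. \<forall>k \<in> Z_diamond - S_set \<omega> M1 M2. H k = 0}"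

definition F_B :: "real \<Rightarrow> 'n::finite series set" where
  "F_B M = {H \<in> F_diamond. \<forall>k \<in> B_set M. H k = 0}"

end

theory Submission imports Defs begin

text \<open>
  Antisymmetrising the bracket shows that the equation for the coefficient \<open>H k\<close> reads
  \<open>d/d\<delta> (H k) = - \<bar>\<langle>\<omega>, k'\<rangle>\<bar> H k - (quadratic form in coefficients of degree < deg k)\<close>, where a product
  \<open>H a * H b\<close> carries the factor \<open>\<sigma> a - \<sigma> b\<close>. The system is triangular with respect to the degree,
  so it is solved uniquely by variation of constants. A product that contributes to \<open>H k\<close> has
  frequencies \<open>\<langle>\<omega>, a'\<rangle>\<close> and \<open>\<langle>\<omega>, b'\<rangle>\<close> of different signs which sum up to \<open>\<langle>\<omega>, k'\<rangle>\<close>; hence the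
  latter lies between them, and both subspaces are preserved degree by degree.
\<close>

section \<open>Additivity of degree, index difference and frequency\<close>

lemma deg_add: "deg (k + l) = deg k + deg l"
  by (simp add: deg_def sum.distrib)

lemma sum_axis_one: "(\<Sum>i\<in>UNIV. axis j (1::nat) $ i) = 1"
  by (simp add: axis_def)

lemma deg_axis [simp]: "deg (axis j (Suc 0), 0) = 1" "deg (0, axis j (Suc 0)) = 1"
  using sum_axis_one[of j] by (simp_all add: deg_def)

lemma idiff_add: "idiff (k + l) = idiff k + idiff l"
  by (simp add: idiff_def vec_eq_iff)

lemma idiff_axis_cancel: "idiff (0, axis j 1) + idiff (axis j 1, 0) = 0"
  by (simp add: idiff_def vec_eq_iff)

lemma freq_add: "freq \<omega> (p + q) = freq \<omega> p + freq \<omega> q"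
  by (simp add: freq_def inner_vec_def distrib_left sum.distrib)

lemma freq_idiff:
  "freq \<omega> (idiff k) = (\<Sum>j\<in>UNIV. \<omega> $ j * (real (snd k $ j) - real (fst k $ j)))"
  by (simp add: freq_def idiff_def inner_vec_def)

section \<open>The bracket with the quadratic part \<open>H2\<close>\<close>

lemma d_z_H2: "d_z j (H2 \<omega>) m = (if m = (0, axis j 1) then complex_of_real (\<omega> $ j) else 0)"
proof -
  have "m + (axis j 1, 0) = (axis i 1, axis i 1) \<longleftrightarrow> i = j \<and> m = (0, axis j 1)" for i
  proof
    assume *: "m + (axis j 1, 0) = (axis i 1, axis i 1)"
    \<comment> \<open>Component \<open>j\<close> is at least 1 on the left, which forces
      \<open>axis i 1\<close> to be nonzero there.\<close>
    then have "(fst m + axis j 1) $ j = axis i 1 $ j"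
      by (metis fst_conv fst_add)
    then have "i = j"
      by (auto simp: axis_def split: if_splits)
    with * show "i = j \<and> m = (0, axis j 1)"
      by (cases m) auto
  qed auto
  then have "H2 \<omega> (m + (axis j 1, 0)) =
      (\<Sum>i\<in>UNIV. if i = j then (if m = (0, axis j 1) then complex_of_real (\<omega> $ i) else 0) else 0)"
    unfolding H2_def by (intro sum.cong) auto
  then show ?thesis
    by (simp add: d_z_def)
qed

lemma d_zb_H2: "d_zb j (H2 \<omega>) m = (if m = (axis j 1, 0) then complex_of_real (\<omega> $ j) else 0)"
proof -
  have "m + (0, axis j 1) = (axis i 1, axis i 1) \<longleftrightarrow> i = j \<and> m = (axis j 1, 0)" for i
  proof
    assume *: "m + (0, axis j 1) = (axis i 1, axis i 1)"
    then have "(snd m + axis j 1) $ j = axis i 1 $ j"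
      by (metis snd_conv snd_add)
    then have "i = j"
      by (auto simp: axis_def split: if_splits)
    with * show "i = j \<and> m = (axis j 1, 0)"
      by (cases m) auto
  qed auto
  then have "H2 \<omega> (m + (0, axis j 1)) =
      (\<Sum>i\<in>UNIV. if i = j then (if m = (axis j 1, 0) then complex_of_real (\<omega> $ i) else 0) else 0)"
    unfolding H2_def by (intro sum.cong) auto
  then show ?thesis
    by (simp add: d_zb_def)
qed

text \<open>Writing the index as \<open>l + p\<close> avoids truncated subtraction: by cancellation
  \<open>(l, p)\<close> is the only split of \<open>l + p\<close> that meets the monomial.\<close>

lemma series_mult_monomial:
  "series_mult F (\<lambda>m. if m = p then c else 0) (l + p) = F l * c"
proof -
  have *: "(case x of (l', m) \<Rightarrow> F l' * (if m = p then c else 0)) =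
      (if x = (l, p) then F l * c else 0)" if "x \<in> {(l', m). l' + m = l + p}" for x
  proof -
    obtain l' m where x: "x = (l', m)"
      by (cases x)
    with that have "l' + m = l + p"
      by simp
    with x show ?thesis
      by (cases "m = p") simp_all
  qed
  have "series_mult F (\<lambda>m. if m = p then c else 0) (l + p) =
      (\<Sum>x\<in>{(l', m). l' + m = l + p}. if x = (l, p) then F l * c else 0)"
    unfolding series_mult_def by (intro sum.cong refl *)
  also have "\<dots> = F l * c"
    using finite_bimulti_splits[of "l + p"] by (simp add: sum.delta)
  finally show ?thesis .
qed

lemma series_mult_monomial_eq_0:
  assumes "\<And>l. l + p \<noteq> k"
  shows "series_mult F (\<lambda>m. if m = p then c else 0) k = 0"
  unfolding series_mult_def using assms by (intro sum.neutral ballI) (clarsimp, metis add_Pair)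

lemma vec_nat_minus_axis:
  fixes v :: "nat ^ 'n"
  assumes "v $ j \<noteq> 0"
  shows "\<exists>u. v = u + axis j 1"
proof
  show "v = (\<chi> i. v $ i - axis j 1 $ i) + axis j 1"
    using assms by (simp add: vec_eq_iff axis_def)
qed

text \<open>Differentiation by \<open>zb j\<close> lowers an exponent and the factor
  \<open>zb j\<close> from \<open>H2\<close> restores it, so the product acts on monomials as an
  Euler operator: it multiplies by the exponent. If the exponent is 0, no split reaches
  \<open>k\<close>.\<close>

lemma series_mult_d_zb_H2:
  "series_mult (d_zb j F) (d_z j (H2 \<omega>)) k = of_nat (snd k $ j) * F k * complex_of_real (\<omega> $ j)"
proof (cases "snd k $ j = 0")
  case True
  then have "l + (0, axis j 1) \<noteq> k" for l
    by (auto simp: axis_def)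
  with True show ?thesis
    by (simp add: d_z_H2[abs_def] series_mult_monomial_eq_0)
next
  case False
  then obtain u where "snd k = u + axis j 1"
    using vec_nat_minus_axis by blast
  then have k: "k = (fst k, u) + (0, axis j 1)"
    by (simp add: prod_eq_iff)
  have "series_mult (d_zb j F) (d_z j (H2 \<omega>)) ((fst k, u) + (0, axis j 1)) =
      d_zb j F (fst k, u) * complex_of_real (\<omega> $ j)"
    unfolding d_z_H2[abs_def] by (rule series_mult_monomial)
  also have "\<dots> = of_nat (snd k $ j) * F k * complex_of_real (\<omega> $ j)"
    using \<open>snd k = _\<close> k[symmetric] by (simp add: d_zb_def)
  finally show ?thesis
    using k by simp
qed

lemma series_mult_d_z_H2:
  "series_mult (d_z j F) (d_zb j (H2 \<omega>)) k = of_nat (fst k $ j) * F k * complex_of_real (\<omega> $ j)"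
proof (cases "fst k $ j = 0")
  case True
  then have "l + (axis j 1, 0) \<noteq> k" for l
    by (auto simp: axis_def)
  with True show ?thesis
    by (simp add: d_zb_H2[abs_def] series_mult_monomial_eq_0)
next
  case False
  then obtain u where "fst k = u + axis j 1"
    using vec_nat_minus_axis by blast
  then have k: "k = (u, snd k) + (axis j 1, 0)"
    by (simp add: prod_eq_iff)
  have "series_mult (d_z j F) (d_zb j (H2 \<omega>)) ((u, snd k) + (axis j 1, 0)) =
      d_z j F (u, snd k) * complex_of_real (\<omega> $ j)"
    unfolding d_zb_H2[abs_def] by (rule series_mult_monomial)
  also have "\<dots> = of_nat (fst k $ j) * F k * complex_of_real (\<omega> $ j)"
    using \<open>fst k = _\<close> k[symmetric] by (simp add: d_z_def)
  finally show ?thesis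
    using k by simp
qed

text \<open>The Euler operators in \<open>zb j\<close> and \<open>z j\<close> enter with opposite
  signs, so their eigenvalues combine to the frequency of the monomial.\<close>

lemma poisson_H2: "poisson F (H2 \<omega>) k = \<i> * complex_of_real (freq \<omega> (idiff k)) * F k"
  by (simp add: poisson_def series_mult_d_zb_H2 series_mult_d_z_H2 freq_idiff
      sum_distrib_left sum_distrib_right algebra_simps)

section \<open>The bracket with \<open>H\<close> itself and its triangular structure\<close>

lemma series_mult_add_right:
  "series_mult F (\<lambda>l. G l + G' l) k = series_mult F G k + series_mult F G' k"
  by (simp add: series_mult_def case_prod_unfold distrib_left sum.distrib)

lemma series_mult_commute: "series_mult F G k = series_mult G F k"
  unfolding series_mult_def
  by (rule sum.reindex_bij_witness[of _ prod.swap prod.swap]) (auto simp: add.commute)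

lemma poisson_add_right:
  "poisson F (\<lambda>l. G l + G' l) k = poisson F G k + poisson F G' k"
proof -
  have "d_z j (\<lambda>l. G l + G' l) = (\<lambda>l. d_z j G l + d_z j G' l)"
    and "d_zb j (\<lambda>l. G l + G' l) = (\<lambda>l. d_zb j G l + d_zb j G' l)" for j
    by (auto simp: d_z_def d_zb_def distrib_left)
  then show ?thesis
    by (simp add: poisson_def series_mult_add_right sum.distrib sum_subtractf algebra_simps)
qed

text \<open>The closed form of the bracket of \<open>xi \<omega> H\<close> with \<open>H\<close>.
  The shifted indices are those of the coefficients of \<open>H\<close> before differentiation by
  \<open>zb j\<close> and \<open>z j\<close>.\<close>

definition quad :: "real ^ 'n::finite \<Rightarrow> 'n series \<Rightarrow> 'n series" where
  "quad \<omega> H k = (\<Sum>j\<in>UNIV. \<Sum>(l, m)\<in>{(l, m). l + m = k}.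
     of_nat ((snd l $ j + 1) * (fst m $ j + 1)) *
     complex_of_real (sigma \<omega> (idiff (l + (0, axis j 1))) - sigma \<omega> (idiff (m + (axis j 1, 0)))) *
     (H (l + (0, axis j 1)) * H (m + (axis j 1, 0))))"

lemma F_diamond_iff: "H \<in> F_diamond \<longleftrightarrow> (\<forall>k. deg k < 3 \<longrightarrow> H k = 0)"
  by (simp add: F_diamond_def Z_diamond_def not_le del: split_paired_All)

lemma xi_F_diamond:
  assumes "H \<in> F_diamond"
  shows "xi \<omega> H k = - \<i> * complex_of_real (sigma \<omega> (idiff k)) * H k"
  using assms by (simp add: xi_def F_diamond_iff del: split_paired_All)

lemma poisson_xi_self:
  assumes "H \<in> F_diamond"
  shows "poisson (xi \<omega> H) H k = quad \<omega> H k"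
proof -
  have "\<i> * (series_mult (d_zb j (xi \<omega> H)) (d_z j H) k
            - series_mult (d_zb j H) (d_z j (xi \<omega> H)) k) =
    (\<Sum>(l, m)\<in>{(l, m). l + m = k}.
     of_nat ((snd l $ j + 1) * (fst m $ j + 1)) *
     complex_of_real (sigma \<omega> (idiff (l + (0, axis j 1))) - sigma \<omega> (idiff (m + (axis j 1, 0)))) *
     (H (l + (0, axis j 1)) * H (m + (axis j 1, 0))))" for j
    unfolding series_mult_def sum_subtractf[symmetric] sum_distrib_left
    by (intro sum.cong) (auto simp: d_z_def d_zb_def xi_F_diamond[OF assms] algebra_simps)
  then show ?thesis
    unfolding poisson_def quad_def sum_distrib_left
    \<comment> \<open>Swapping the second product puts the \<open>zb\<close> derivative first in
      both, so that they share the pair \<open>(l, m)\<close>; the factors \<i> and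
      \<open>- \<i>\<close> then multiply to 1, leaving the difference of signs.\<close>
    by (subst (2) series_mult_commute) simp
qed

text \<open>The sign in \<open>xi\<close> times the frequency from \<open>H2\<close> is its absolute
  value, so the linear part of the flow is nonexpanding.\<close>

lemma poisson_xi:
  assumes "H \<in> F_diamond"
  shows "poisson (xi \<omega> H) (\<lambda>l. H2 \<omega> l + H l) k =
    complex_of_real \<bar>freq \<omega> (idiff k)\<bar> * H k + quad \<omega> H k"
proof -
  have "\<i> * complex_of_real c * (- \<i> * complex_of_real (sgn c) * x) = complex_of_real \<bar>c\<bar> * x"
    for c x
    by (simp add: abs_sgn algebra_simps)
  then show ?thesis
    by (simp only: poisson_add_right poisson_H2 poisson_xi_self[OF assms] xi_F_diamond[OF assms]
        sigma_def)
qed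

text \<open>The two unit shifts raise the total degree by 2 and cancel in \<open>idiff\<close>;
  equal signs make the factor in front of a product vanish.\<close>

lemma quad_eq_0:
  assumes "\<And>a b. \<lbrakk>deg a + deg b = deg k + 2; idiff a + idiff b = idiff k;
      sigma \<omega> (idiff a) \<noteq> sigma \<omega> (idiff b)\<rbrakk> \<Longrightarrow> H a = 0 \<or> H b = 0"
  shows "quad \<omega> H k = 0"
proof -
  have "of_nat ((snd l $ j + 1) * (fst m $ j + 1)) *
     complex_of_real (sigma \<omega> (idiff (l + (0, axis j 1))) - sigma \<omega> (idiff (m + (axis j 1, 0)))) *
     (H (l + (0, axis j 1)) * H (m + (axis j 1, 0))) = 0" if "l + m = k" for j l m
  proof -
    let ?a = "l + (0, axis j 1)" and ?b = "m + (axis j 1, 0)"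
    have "deg ?a + deg ?b = deg k + 2"
      by (simp add: deg_add flip: that)
    moreover have "idiff ?a + idiff ?b = idiff k"
      using idiff_axis_cancel[of j] by (simp add: idiff_add algebra_simps flip: that)
    ultimately have "sigma \<omega> (idiff ?a) \<noteq> sigma \<omega> (idiff ?b) \<Longrightarrow> H ?a = 0 \<or> H ?b = 0"
      by (rule assms)
    then show ?thesis
      by (cases "sigma \<omega> (idiff ?a) = sigma \<omega> (idiff ?b)") auto
  qed
  then show ?thesis
    unfolding quad_def case_prod_unfold by (intro sum.neutral ballI) blast
qed

text \<open>If both degrees are at least 3 and sum to \<open>deg k + 2\<close>, each is at most
  \<open>deg k - 1\<close>. Every other product is zero for both series.\<close>

lemma quad_cong:
  assumes "H \<in> F_diamond" "H' \<in> F_diamond" "\<And>a. deg a < deg k \<Longrightarrow> H a = H' a"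
  shows "quad \<omega> H k = quad \<omega> H' k"
proof -
  have *: "H a * H b = H' a * H' b" if "deg a + deg b = deg k + 2" for a b
  proof (cases "deg a < 3 \<or> deg b < 3")
    case True
    then show ?thesis
      using assms(1,2) by (auto simp: F_diamond_iff simp del: split_paired_All)
  next
    case False
    with that assms(3)[of a] assms(3)[of b] show ?thesis
      by auto
  qed
  have "H (l + (0, axis j 1)) * H (m + (axis j 1, 0)) =
      H' (l + (0, axis j 1)) * H' (m + (axis j 1, 0))" if "l + m = k" for j l m
    by (intro *) (simp add: deg_add flip: that)
  then show ?thesis
    unfolding quad_def by (intro sum.cong) auto
qed

section \<open>The coefficient equations: uniqueness and propagation of zeros\<close>

lemma flow_solution_iff:
  "flow_solution \<omega> H0 H \<longleftrightarrow> (\<forall>t\<ge>0. H t \<in> F_diamond) \<and> H 0 = H0 \<and>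
     (\<forall>t\<ge>0. \<forall>k. ((\<lambda>s. H s k) has_vector_derivative
        - (complex_of_real \<bar>freq \<omega> (idiff k)\<bar> * H t k + quad \<omega> (H t) k)) (at t within {0..}))"
  by (simp add: flow_solution_def poisson_xi cong: conj_cong del: split_paired_All)

lemma flow_solution_has_vector_derivative:
  assumes "flow_solution \<omega> H0 H" "0 \<le> t"
  shows "((\<lambda>s. H s k) has_vector_derivative
    - (complex_of_real \<bar>freq \<omega> (idiff k)\<bar> * H t k + quad \<omega> (H t) k)) (at t within {0..})"
  using assms unfolding flow_solution_iff by blast

lemma has_vector_derivative_exp_real:
  "((\<lambda>t. complex_of_real (exp (c * t))) has_vector_derivative complex_of_real (c * exp (c * t)))
     (at t within A)"
  by (intro has_vector_derivative_of_real)
    (auto intro!: derivative_eq_intros simp: has_real_derivative_iff_has_vector_derivative[symmetric])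

text \<open>The integrating factor \<open>exp (c * t)\<close> turns \<open>D\<close> into a function
  with zero derivative on the half-line, hence a constant.\<close>

lemma linear_ode_eq_0:
  fixes D :: "real \<Rightarrow> complex"
  assumes "\<And>t. 0 \<le> t \<Longrightarrow> (D has_vector_derivative - (complex_of_real c * D t)) (at t within {0..})"
    and "D 0 = 0" and "0 \<le> t"
  shows "D t = 0"
proof -
  let ?E = "\<lambda>t. complex_of_real (exp (c * t)) * D t"
  have "(?E has_vector_derivative 0) (at s within {0..})" if "s \<in> {0..}" for s
    using that
    by (auto intro!: derivative_eq_intros assms(1) has_vector_derivative_exp_real
        simp: has_vector_derivative_mult algebra_simps)
  then obtain C where C: "\<And>s. s \<in> {0..} \<Longrightarrow> ?E s = C"
    using has_vector_derivative_zero_constant[of "{0..}" ?E] by (metis convex_real_interval(1))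
  from C[of 0] C[of t] assms show ?thesis
    by simp
qed

text \<open>By induction on the degree the quadratic terms of both solutions agree, so the
  difference of coefficients solves a homogeneous linear equation with zero initial value.\<close>

lemma flow_solution_unique:
  assumes "flow_solution \<omega> H0 H" "flow_solution \<omega> H0 H'" "0 \<le> t"
  shows "H t = H' t"
proof -
  have "\<forall>t\<ge>0. H t k = H' t k" for k
  proof (induction "deg k" arbitrary: k rule: less_induct)
    case less
    have q: "quad \<omega> (H t) k = quad \<omega> (H' t) k" if "0 \<le> t" for t
      using that assms less by (intro quad_cong) (auto simp: flow_solution_iff)
    have "((\<lambda>s. H s k - H' s k) has_vector_derivative
        - (complex_of_real \<bar>freq \<omega> (idiff k)\<bar> * (H t k - H' t k))) (at t within {0..})"
      if "0 \<le> t" for t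
    proof -
      have "((\<lambda>s. H s k - H' s k) has_vector_derivative
        - (complex_of_real \<bar>freq \<omega> (idiff k)\<bar> * H t k + quad \<omega> (H t) k)
        - - (complex_of_real \<bar>freq \<omega> (idiff k)\<bar> * H' t k + quad \<omega> (H' t) k)) (at t within {0..})"
        by (intro has_vector_derivative_diff flow_solution_has_vector_derivative[OF assms(1) that]
            flow_solution_has_vector_derivative[OF assms(2) that])
      then show ?thesis
        by (simp add: q[OF that] algebra_simps)
    qed
    moreover have "H 0 k - H' 0 k = 0"
      using assms(1,2) by (simp add: flow_solution_iff)
    ultimately have "\<forall>t\<ge>0. H t k - H' t k = 0"
      using linear_ode_eq_0[of "\<lambda>t. H t k - H' t k"] by blast
    then show ?case
      by simp
  qed
  then show ?thesis
    using assms(3) by blast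
qed

text \<open>The closure condition says that each product feeding an index in \<open>A\<close> has a
  factor in \<open>A\<close> of lower degree. By induction on the degree that factor is zero, and a
  homogeneous linear equation remains.\<close>

lemma flow_solution_vanish:
  assumes H: "flow_solution \<omega> H0 H" and H0: "\<And>k. k \<in> A \<Longrightarrow> H0 k = 0"
    and closed: "\<And>k a b. \<lbrakk>k \<in> A; deg a < deg k; deg b < deg k; a \<in> Z_diamond; b \<in> Z_diamond;
      idiff a + idiff b = idiff k; sigma \<omega> (idiff a) \<noteq> sigma \<omega> (idiff b)\<rbrakk> \<Longrightarrow> a \<in> A \<or> b \<in> A"
    and k: "k \<in> A" and t: "0 \<le> t"
  shows "H t k = 0"
proof -
  have "\<forall>t\<ge>0. H t k = 0"
    using k
  proof (induction "deg k" arbitrary: k rule: less_induct)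
    case less
    have q: "quad \<omega> (H t) k = 0" if t: "0 \<le> t" for t
    proof (rule quad_eq_0)
      fix a b :: "'a bimulti"
      assume ab: "deg a + deg b = deg k + 2" "idiff a + idiff b = idiff k"
        "sigma \<omega> (idiff a) \<noteq> sigma \<omega> (idiff b)"
      show "H t a = 0 \<or> H t b = 0"
      proof (cases "a \<in> Z_diamond \<and> b \<in> Z_diamond")
        case True
        then have "deg a < deg k" "deg b < deg k"
          using ab(1) by (auto simp: Z_diamond_def)
        with True ab closed less t show ?thesis
          by metis
      next
        case False
        with H t show ?thesis
          unfolding flow_solution_def F_diamond_def by blast
      qed
    qed
    have "((\<lambda>s. H s k) has_vector_derivative
        - (complex_of_real \<bar>freq \<omega> (idiff k)\<bar> * H t k)) (at t within {0..})" if "0 \<le> t" for t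
      using flow_solution_has_vector_derivative[OF H that, of k] by (simp add: q[OF that])
    moreover have "H 0 k = 0"
      using H H0 less.prems by (simp add: flow_solution_iff)
    ultimately show ?case
      using linear_ode_eq_0[of "\<lambda>t. H t k"] by blast
  qed
  with t show ?thesis
    by blast
qed

section \<open>Existence of the flow\<close>

text \<open>
  The formula is variation of constants. The cut-off to degrees below \<open>deg k\<close> makes the recursion
  terminate and does not change the value of \<open>quad\<close>.
\<close>

function solution :: "real ^ 'n::finite \<Rightarrow> 'n series \<Rightarrow> 'n bimulti \<Rightarrow> real \<Rightarrow> complex" where
  "solution \<omega> H0 k t = complex_of_real (exp (- \<bar>freq \<omega> (idiff k)\<bar> * t)) *
     (H0 k - integral {0..t} (\<lambda>s. complex_of_real (exp (\<bar>freq \<omega> (idiff k)\<bar> * s)) *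
        quad \<omega> (\<lambda>m. if deg m < deg k then solution \<omega> H0 m s else 0) k))"
  by pat_completeness auto
termination
  by (relation "Wellfounded.measure (\<lambda>(\<omega>, H0, k, t). deg k)") auto

declare solution.simps [simp del]

lemma variation_of_constants:
  fixes f :: "real \<Rightarrow> complex"
  assumes "continuous_on {0..} f" "0 \<le> t"
  shows "((\<lambda>t. complex_of_real (exp (- c * t)) *
      (x - integral {0..t} (\<lambda>s. complex_of_real (exp (c * s)) * f s)))
    has_vector_derivative
      - (complex_of_real c * (complex_of_real (exp (- c * t)) *
      (x - integral {0..t} (\<lambda>s. complex_of_real (exp (c * s)) * f s))) + f t)) (at t within {0..})"
proof -
  let ?g = "\<lambda>s. complex_of_real (exp (c * s)) * f s"
  let ?I = "\<lambda>t. integral {0..t} ?g"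
  \<comment> \<open>Past \<open>t\<close> by 1, so that the compact interval and the half-line agree
    near \<open>t\<close> and give the same derivative, one-sided only at 0.\<close>
  have "continuous_on {0..t + 1} ?g"
    by (intro continuous_intros continuous_on_subset[OF assms(1)]) auto
  then have "(?I has_vector_derivative ?g t) (at t within {0..t + 1})"
    by (rule integral_has_vector_derivative) (use assms(2) in auto)
  also have "at t within {0..t + 1} = at t within {0..}"
    by (rule at_within_nhd[of _ "{..<t + 1}"]) auto
  finally have I: "(?I has_vector_derivative ?g t) (at t within {0..})" .
  have D: "((\<lambda>t. complex_of_real (exp (- c * t)) * (x - ?I t)) has_vector_derivative
      complex_of_real (exp (- c * t)) * (0 - ?g t) +
      complex_of_real (- c * exp (- c * t)) * (x - ?I t)) (at t within {0..})"
    by (intro has_vector_derivative_mult has_vector_derivative_diff has_vector_derivative_const I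
        has_vector_derivative_exp_real)
  have "complex_of_real (exp (- c * t)) * ?g t = f t"
    by (simp add: exp_minus flip: mult.assoc of_real_mult)
  then have "complex_of_real (exp (- c * t)) * (0 - ?g t) +
      complex_of_real (- c * exp (- c * t)) * (x - ?I t) =
      - (complex_of_real c * (complex_of_real (exp (- c * t)) * (x - ?I t)) + f t)"
    by (simp only: of_real_mult of_real_minus right_diff_distrib[of _ 0]) simp
  with D show ?thesis
    by (simp only:)
qed

lemma continuous_on_quad:
  assumes "\<And>m. continuous_on A (\<lambda>s. G s m)"
  shows "continuous_on A (\<lambda>s. quad \<omega> (G s) k)"
  unfolding quad_def case_prod_unfold by (intro continuous_intros assms)

text \<open>By induction the truncated series below degree 3 is zero, so neither the integral nor
  the initial coefficient contributes.\<close>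

lemma solution_eq_0:
  assumes "H0 \<in> F_diamond" "deg k < 3"
  shows "solution \<omega> H0 k t = 0"
  using assms(2)
proof (induction "deg k" arbitrary: k t rule: less_induct)
  case less
  have "quad \<omega> (\<lambda>m. if deg m < deg k then solution \<omega> H0 m s else 0) k = 0" for s
    using less by (intro quad_eq_0) auto
  moreover have "H0 k = 0"
    using assms(1) less.prems by (simp add: F_diamond_iff del: split_paired_All)
  ultimately show ?case
    by (simp add: solution.simps)
qed

lemma solution_F_diamond:
  assumes "H0 \<in> F_diamond"
  shows "(\<lambda>k. solution \<omega> H0 k t) \<in> F_diamond"
  using solution_eq_0[OF assms] by (simp add: F_diamond_iff)

lemma flow_solution_solution:
  assumes "H0 \<in> F_diamond"
  shows "flow_solution \<omega> H0 (\<lambda>t k. solution \<omega> H0 k t)"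
proof -
  define G where "G k s m = (if deg m < deg k then solution \<omega> H0 m s else 0)" for k m :: "'a bimulti" and s
  have sol: "solution \<omega> H0 k = (\<lambda>t. complex_of_real (exp (- \<bar>freq \<omega> (idiff k)\<bar> * t)) *
     (H0 k - integral {0..t} (\<lambda>s. complex_of_real (exp (\<bar>freq \<omega> (idiff k)\<bar> * s)) *
        quad \<omega> (G k s) k)))" for k
    unfolding G_def by (rule ext) (rule solution.simps)
  \<comment> \<open>Lifting the cut-off is harmless because \<open>quad\<close> at \<open>k\<close>
    sees only degrees below \<open>deg k\<close>.\<close>
  have quad_G: "quad \<omega> (G k t) k = quad \<omega> (\<lambda>k. solution \<omega> H0 k t) k" for k t
    using solution_F_diamond[OF assms, of \<omega> t]
    by (intro quad_cong) (auto simp: F_diamond_iff G_def simp del: split_paired_All)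
  have deriv: "(solution \<omega> H0 k has_vector_derivative
      - (complex_of_real \<bar>freq \<omega> (idiff k)\<bar> * solution \<omega> H0 k t + quad \<omega> (G k t) k))
      (at t within {0..})"
    if "continuous_on {0..} (\<lambda>s. quad \<omega> (G k s) k)" "0 \<le> t" for k t
    unfolding sol[of k] using that by (rule variation_of_constants)
  \<comment> \<open>Differentiability needs a continuous integrand, which is built from lower
    coefficients; hence continuity comes first, by induction on the degree.\<close>
  have cont: "continuous_on {0..} (solution \<omega> H0 k)" for k
  proof (induction "deg k" arbitrary: k rule: less_induct)
    case less
    have "continuous_on {0..} (\<lambda>s. G k s m)" for m
      using less[of m] by (cases "deg m < deg k") (auto simp: G_def)
    from deriv[OF continuous_on_quad[OF this]] show ?case
      by (auto intro!: has_vector_derivative_continuous simp: continuous_on_eq_continuous_within)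
  qed
  have "continuous_on {0..} (\<lambda>s. quad \<omega> (G k s) k)" for k
    by (simp add: quad_G continuous_on_quad cont)
  from deriv[OF this] have "(solution \<omega> H0 k has_vector_derivative
      - (complex_of_real \<bar>freq \<omega> (idiff k)\<bar> * solution \<omega> H0 k t + quad \<omega> (\<lambda>k. solution \<omega> H0 k t) k))
      (at t within {0..})" if "0 \<le> t" for k t
    using that by (simp add: quad_G)
  moreover have "solution \<omega> H0 k 0 = H0 k" for k
    by (simp add: solution.simps)
  ultimately show ?thesis
    using solution_F_diamond[OF assms] by (auto simp: flow_solution_iff)
qed

section \<open>Invariance of the subspaces under the flow\<close>

text \<open>Uniqueness makes the definite description in \<open>flow\<close> well defined, so any
  solution computes it.\<close>

lemma flow_eq:
  assumes "flow_solution \<omega> H0 H" "0 \<le> \<delta>"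
  shows "flow \<omega> \<delta> H0 = H \<delta>"
  unfolding flow_def using assms by (intro the_equality) (blast, metis flow_solution_unique)

lemma flow_F_diamond:
  assumes "H0 \<in> F_diamond" "0 \<le> \<delta>"
  shows "flow \<omega> \<delta> H0 \<in> F_diamond"
  unfolding flow_eq[OF flow_solution_solution[OF assms(1)] assms(2)]
  using assms(1) by (rule solution_F_diamond)

lemma flow_vanish:
  assumes H0: "H0 \<in> F_diamond" and "0 \<le> \<delta>" and "\<And>k. k \<in> A \<Longrightarrow> H0 k = 0"
    and "\<And>k a b. \<lbrakk>k \<in> A; deg a < deg k; deg b < deg k; a \<in> Z_diamond; b \<in> Z_diamond;
      idiff a + idiff b = idiff k; sigma \<omega> (idiff a) \<noteq> sigma \<omega> (idiff b)\<rbrakk> \<Longrightarrow> a \<in> A \<or> b \<in> A"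
    and "k \<in> A"
  shows "flow \<omega> \<delta> H0 k = 0"
proof -
  note sol = flow_solution_solution[OF H0, of \<omega>]
  show ?thesis
    unfolding flow_eq[OF sol \<open>0 \<le> \<delta>\<close>]
    by (rule flow_solution_vanish[OF sol, of A]) (fact assms)+
qed

text \<open>Unequal signs, zero included, mean that one number is nonpositive and the other
  nonnegative, so adding either moves the sum from the other towards it.\<close>

lemma sgn_neq_imp_add_between:
  fixes a b :: real
  assumes "sgn a \<noteq> sgn b"
  shows "a \<le> a + b \<and> a + b \<le> b \<or> b \<le> a + b \<and> a + b \<le> a"
  using assms by (auto simp: sgn_if split: if_splits)

lemma S_set_interact:
  assumes "a \<in> S_set \<omega> M1 M2" "b \<in> S_set \<omega> M1 M2" "k \<in> Z_diamond"
    and "idiff a + idiff b = idiff k" "sigma \<omega> (idiff a) \<noteq> sigma \<omega> (idiff b)"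
  shows "k \<in> S_set \<omega> M1 M2"
proof -
  have "freq \<omega> (idiff k) = freq \<omega> (idiff a) + freq \<omega> (idiff b)"
    by (simp add: freq_add flip: assms(4))
  then have "freq \<omega> (idiff a) \<le> freq \<omega> (idiff k) \<and> freq \<omega> (idiff k) \<le> freq \<omega> (idiff b) \<or>
      freq \<omega> (idiff b) \<le> freq \<omega> (idiff k) \<and> freq \<omega> (idiff k) \<le> freq \<omega> (idiff a)"
    using sgn_neq_imp_add_between assms(5) unfolding sigma_def by metis
  then show ?thesis
    using assms(1-3)
    unfolding S_set_def sigma_def mem_Collect_eq by (meson ereal_less_eq(3) order_trans)
qed

theorem theorem4:
  fixes \<omega> :: "real ^ 'n::finite" and M1 M2 :: ereal and M \<delta> :: real
  assumes "nonresonant \<omega>"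
    and "M1 \<noteq> \<infinity>" and "M2 \<noteq> - \<infinity>" and "M1 \<le> M2"
    and "0 \<le> M"
    and "0 \<le> \<delta>"
  shows "flow \<omega> \<delta> ` F_S \<omega> M1 M2 \<subseteq> F_S \<omega> M1 M2
    \<and> flow \<omega> \<delta> ` F_B M \<subseteq> F_B M"
proof (intro conjI image_subsetI)
  fix H0
  assume H0: "H0 \<in> F_S \<omega> M1 M2"
  have "flow \<omega> \<delta> H0 k = 0" if "k \<in> Z_diamond - S_set \<omega> M1 M2" for k
  proof (rule flow_vanish[OF _ \<open>0 \<le> \<delta>\<close> _ _ that])
    show "H0 \<in> F_diamond" "\<And>k. k \<in> Z_diamond - S_set \<omega> M1 M2 \<Longrightarrow> H0 k = 0"
      using H0 by (simp_all add: F_S_def)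
  \<comment> \<open>Contrapositive of the closure condition: two interacting indices in
    \<open>S_set\<close> keep \<open>k\<close> in \<open>S_set\<close>.\<close>
  qed (use S_set_interact in blast)
  with H0 \<open>0 \<le> \<delta>\<close> show "flow \<omega> \<delta> H0 \<in> F_S \<omega> M1 M2"
    by (simp add: F_S_def flow_F_diamond)
next
  fix H0 :: "'n series"
  assume H0: "H0 \<in> F_B M"
  have "flow \<omega> \<delta> H0 k = 0" if "k \<in> B_set M" for k
  proof (rule flow_vanish[OF _ \<open>0 \<le> \<delta>\<close> _ _ that])
    show "H0 \<in> F_diamond" "\<And>k. k \<in> B_set M \<Longrightarrow> H0 k = 0"
      using H0 by (simp_all add: F_B_def)
  \<comment> \<open>Here the degree alone suffices: \<open>deg a < deg k\<close> puts
    \<open>a\<close> into \<open>B_set M\<close>.\<close>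
  qed (simp add: B_set_def)
  with H0 \<open>0 \<le> \<delta>\<close> show "flow \<omega> \<delta> H0 \<in> F_B M"
    by (simp add: F_B_def flow_F_diamond)
qed

end
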